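(* Let $\mathcal{A}=(Q,A,\delta)$ be a simple synchronizing deterministic finite automaton and let $\chi$ be a reset or weakly reset group coloring of $\mathcal{A}$. Then either the automata semigroup $\mathcal{S}(\mathcal{M}(\mathcal{A},\chi))$ is a free semigroup, or the Mealy automaton $\mathcal{M}(\mathcal{A},\chi)$ is singular.
   Context: A DFA is a triple $\mathcal{A}=(Q,A,\delta)$ with $Q$ a finite set of states, $A$ a finite alphabet, $\delta:Q\times A\to Q$; write $q\cdot a=\delta(q,a)$, extended to words $u\in A^*$ and to subsets by $H\cdot u=\{q\cdot u:q\in H\}$. $\mathrm{Syn}(\mathcal{A})=\{u\in A^*:|Q\cdot u|=1\}$, and $\mathcal{A}$ is synchronizing if $\mathrm{Syn}(\mathcal{A})\ne\emptyset$. A congruence on $\mathcal{A}$ is an equivalence relation $\rho$ on $Q$ such that $q\rho p$ implies $(q\cdot a)\rho(p\cdot a)$ for all $a\in A$; $\mathcal{A}$ is simple if its only congruences are the identity relation and the universal relation. A group coloring $\chi$ of $\mathcal{A}$ assigns to each edge of the underlying digraph (one edge $q\to q\cdot a$ for each pair $(q,a)\in Q\times A$) a letter of $A$ so that, for each state $q$, the map from the outgoing edges of $q$ to $A$ is a bijection. The associated invertible Mealy automaton is $\mathcal{M}(\mathcal{A},\chi)=(Q,A,\delta,\lambda)$ where $\lambda(q,a)$ is the color of the edge given by $(q,a)$; so each $a\mapsto\lambda(q,a)$ is a permutation of $A$. For a Mealy automaton $\mathcal{M}=(Q,A,\delta,\lambda)$ put $q\circ a=\lambda(q,a)$, extended by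 $q\circ(ua)=(q\circ u)((q\cdot u)\circ a)$, and $\mathcal{M}_q:A^*\to A^*$, $\mathcal{M}_q(u)=q\circ u$. $\mathcal{S}(\mathcal{M})$ is the semigroup of transformations of $A^*$ generated by $\{\mathcal{M}_q:q\in Q\}$. $\mathrm{Syn}(\mathcal{M})$ is the set of reset words of the DFA $(Q,A,\delta)$. $\mathcal{M}$ is reset if it is synchronizing and $\mathcal{M}_q(\mathrm{Syn}(\mathcal{M}))\subseteq\mathrm{Syn}(\mathcal{M})$ for all $q\in Q$. $\mathcal{M}$ is weakly reset (with respect to $H$) if it is synchronizing and $H\subseteq\mathrm{Syn}(\mathcal{M})$ is a non-empty two-sided ideal of $A^*$ with $\mathcal{M}_q(H)\subseteq H$ for all $q\in Q$. In the reset case set $H=\mathrm{Syn}(\mathcal{M})$. The modified state function of $q$ is $\widetilde{\lambda_q}:H\to Q$, sending $u$ to the unique element of $Q\cdot(q\circ u)$. A (weakly) reset Mealy automaton is singular if all its modified state functions $\widetilde{\lambda_q}$, $q\in Q$, are equal. A group coloring $\chi$ of a synchronizing DFA $\mathcal{A}$ is reset (weakly reset) if $\mathcal{M}(\mathcal{A},\chi)$ is reset (weakly reset). *)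

theory Defs
  imports Main "HOL-Library.FuncSet"
begin

text \<open>A DFA is given by its transition function; the state set and the alphabet are the (finite)
  types \<open>'q\<close> and \<open>'a\<close>, and \<open>A\<^sup>*\<close> is the type \<open>'a list\<close>.\<close>

type_synonym ('q, 'a) dfa = "'q \<Rightarrow> 'a \<Rightarrow> 'q"

definition run :: "('q, 'a) dfa \<Rightarrow> 'q \<Rightarrow> 'a list \<Rightarrow> 'q" where
  "run \<delta> q u = foldl \<delta> q u"

definition run_set :: "('q, 'a) dfa \<Rightarrow> 'q set \<Rightarrow> 'a list \<Rightarrow> 'q set" where
  "run_set \<delta> H u = (\<lambda>q. run \<delta> q u) ` H"

definition Syn :: "('q, 'a) dfa \<Rightarrow> 'a list set" where
  "Syn \<delta> = {u. card (run_set \<delta> UNIV u) = 1}"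

definition synchronizing :: "('q, 'a) dfa \<Rightarrow> bool" where
  "synchronizing \<delta> \<longleftrightarrow> Syn \<delta> \<noteq> {}"

definition dfa_congruence :: "('q, 'a) dfa \<Rightarrow> ('q \<times> 'q) set \<Rightarrow> bool" where
  "dfa_congruence \<delta> \<rho> \<longleftrightarrow>
     equiv UNIV \<rho> \<and> (\<forall>q p a. (q, p) \<in> \<rho> \<longrightarrow> (\<delta> q a, \<delta> p a) \<in> \<rho>)"

definition simple_dfa :: "('q, 'a) dfa \<Rightarrow> bool" where
  "simple_dfa \<delta> \<longleftrightarrow> (\<forall>\<rho>. dfa_congruence \<delta> \<rho> \<longrightarrow> \<rho> = Id \<or> \<rho> = UNIV)"

record ('q, 'a) mealy =
  next_state :: "('q, 'a) dfa"
  out_letter :: "'q \<Rightarrow> 'a \<Rightarrow> 'a"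

text \<open>\<open>act M q u\<close> is \<open>q \<circ> u\<close>, and \<open>act M q\<close> is the transformation \<open>M\<^sub>q\<close> of \<open>A\<^sup>*\<close>. The recursion
  peels off the first letter; \<open>act_snoc\<close> is the equation that peels off the last one.\<close>

primrec act :: "('q, 'a) mealy \<Rightarrow> 'q \<Rightarrow> 'a list \<Rightarrow> 'a list" where
  "act M q [] = []"
| "act M q (a # u) = out_letter M q a # act M (next_state M q a) u"

lemma act_snoc: "act M q (u @ [a]) = act M q u @ [out_letter M (run (next_state M) q u) a]"
  by (induction u arbitrary: q) (simp_all add: run_def)

inductive_set generated_semigroup :: "('b \<Rightarrow> 'b) set \<Rightarrow> ('b \<Rightarrow> 'b) set"
  for G :: "('b \<Rightarrow> 'b) set" where
  generator: "f \<in> G \<Longrightarrow> f \<in> generated_semigroup G"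
| comp: "f \<in> generated_semigroup G \<Longrightarrow> g \<in> generated_semigroup G \<Longrightarrow>
    f \<circ> g \<in> generated_semigroup G"

definition automaton_semigroup :: "('q, 'a) mealy \<Rightarrow> ('a list \<Rightarrow> 'a list) set" where
  "automaton_semigroup M = generated_semigroup (range (act M))"

text \<open>A semigroup \<open>S\<close> of transformations is free if it is isomorphic to \<open>X\<^sup>+\<close> for some set \<open>X\<close>.
  Such an \<open>X\<close> is in bijection with a subset of \<open>S\<close>, so nothing is lost by taking its elements
  from the type of elements of \<open>S\<close>.\<close>

definition free_semigroup :: "('b \<Rightarrow> 'b) set \<Rightarrow> bool" where
  "free_semigroup S \<longleftrightarrow>
     (\<exists>(X :: ('b \<Rightarrow> 'b) set) \<phi>.
        bij_betw \<phi> {w \<in> lists X. w \<noteq> []} S \<and>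
        (\<forall>v\<in>lists X. \<forall>w\<in>lists X. v \<noteq> [] \<longrightarrow> w \<noteq> [] \<longrightarrow> \<phi> (v @ w) = \<phi> v \<circ> \<phi> w))"

text \<open>The edges of the underlying digraph are the pairs \<open>(q, a)\<close>; those leaving \<open>q\<close> form
  \<open>{q} \<times> UNIV\<close>.\<close>

definition group_coloring :: "('q, 'a) dfa \<Rightarrow> ('q \<times> 'a \<Rightarrow> 'a) \<Rightarrow> bool" where
  "group_coloring \<delta> \<chi> \<longleftrightarrow> (\<forall>q. bij_betw \<chi> ({q} \<times> UNIV) UNIV)"

definition coloring_mealy :: "('q, 'a) dfa \<Rightarrow> ('q \<times> 'a \<Rightarrow> 'a) \<Rightarrow> ('q, 'a) mealy" where
  "coloring_mealy \<delta> \<chi> = \<lparr>next_state = \<delta>, out_letter = (\<lambda>q a. \<chi> (q, a))\<rparr>"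

definition reset_mealy :: "('q, 'a) mealy \<Rightarrow> bool" where
  "reset_mealy M \<longleftrightarrow> synchronizing (next_state M) \<and>
     (\<forall>q. act M q ` Syn (next_state M) \<subseteq> Syn (next_state M))"

definition two_sided_ideal :: "'a list set \<Rightarrow> bool" where
  "two_sided_ideal H \<longleftrightarrow> (\<forall>u\<in>H. \<forall>v. v @ u \<in> H \<and> u @ v \<in> H)"

definition weakly_reset_mealy :: "('q, 'a) mealy \<Rightarrow> 'a list set \<Rightarrow> bool" where
  "weakly_reset_mealy M H \<longleftrightarrow> synchronizing (next_state M) \<and>
     H \<subseteq> Syn (next_state M) \<and> H \<noteq> {} \<and> two_sided_ideal H \<and> (\<forall>q. act M q ` H \<subseteq> H)"

definition reset_coloring :: "('q, 'a) dfa \<Rightarrow> ('q \<times> 'a \<Rightarrow> 'a) \<Rightarrow> bool" where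
  "reset_coloring \<delta> \<chi> \<longleftrightarrow> group_coloring \<delta> \<chi> \<and> reset_mealy (coloring_mealy \<delta> \<chi>)"

definition weakly_reset_coloring ::
    "('q, 'a) dfa \<Rightarrow> ('q \<times> 'a \<Rightarrow> 'a) \<Rightarrow> 'a list set \<Rightarrow> bool" where
  "weakly_reset_coloring \<delta> \<chi> H \<longleftrightarrow>
     group_coloring \<delta> \<chi> \<and> weakly_reset_mealy (coloring_mealy \<delta> \<chi>) H"

text \<open>The modified state function of \<open>q\<close> is a function on \<open>H\<close> only, hence the restriction: equality
  of two such functions is equality on \<open>H\<close>.\<close>

definition modified_state :: "('q, 'a) mealy \<Rightarrow> 'a list set \<Rightarrow> 'q \<Rightarrow> 'a list \<Rightarrow> 'q" where
  "modified_state M H q = (\<lambda>u\<in>H. the_elem (run_set (next_state M) UNIV (act M q u)))"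

definition singular :: "('q, 'a) mealy \<Rightarrow> 'a list set \<Rightarrow> bool" where
  "singular M H \<longleftrightarrow> (\<forall>p q. modified_state M H p = modified_state M H q)"

end

(* Write r u for the state reached by a reset word u. For h in H the output of q \<cdot> a on h is a
   reset word as well, so the modified state function of q \<cdot> a at h is that of q at ah; hence
   "equal modified state functions" is a congruence, and by simplicity it is either universal
   (the singular case) or the identity. In the latter case the states generate freely. If two
   products of states act equally, then so do the two products of states reached after reading h;
   both of them begin with r h, which can be cancelled because the states act surjectively, and the
   next states are the values at h of the modified state functions of the original first states.
   By induction, products of equal length that act equally are equal. Products of different lengths
   are reduced by the same cancellation to a non-empty product acting as the identity. Reading a
   letter a turns it into a product of the same length that still acts as the identity, hence into
   itself, so that its first state s satisfies s \<cdot> a = s. Thus s is a sink, r is constant and all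
   modified state functions are equal. *)
theory Submission
  imports Defs
begin

section \<open>Reset words and the action of words of states\<close>

lemma run_simps [simp]: "run \<delta> q [] = q" "run \<delta> q (a # u) = run \<delta> (\<delta> q a) u"
  by (simp_all add: run_def)

lemma run_append [simp]: "run \<delta> q (u @ v) = run \<delta> (run \<delta> q u) v"
  by (simp add: run_def)

lemma Syn_iff: "u \<in> Syn \<delta> \<longleftrightarrow> (\<exists>s. \<forall>q. run \<delta> q u = s)"
  unfolding Syn_def run_set_def by (auto simp: card_1_singleton_iff)

text \<open>Uses \<open>the_elem\<close> as \<open>modified_state\<close> does, so that the two can
  be compared by unfolding; the value is meaningful on reset words only.\<close>

definition reset_state :: "('q, 'a) dfa \<Rightarrow> 'a list \<Rightarrow> 'q" where
  "reset_state \<delta> u = the_elem (run_set \<delta> UNIV u)"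

lemma run_reset: "u \<in> Syn \<delta> \<Longrightarrow> run \<delta> q u = reset_state \<delta> u"
  by (auto simp: Syn_iff reset_state_def run_set_def)

lemma two_sided_ideal_Syn: "two_sided_ideal (Syn \<delta>)"
  unfolding two_sided_ideal_def by (auto simp: Syn_iff)

lemma act_append: "act M q (u @ v) = act M q u @ act M (run (next_state M) q u) v"
  by (induction u arbitrary: q) simp_all

lemma length_act [simp]: "length (act M q u) = length u"
  by (induction u arbitrary: q) simp_all

text \<open>A preimage is built letter by letter, each letter chosen at the state to which the
  previous ones lead.\<close>

lemma surj_act:
  assumes "\<And>q. surj (out_letter M q)"
  shows "surj (act M q)"
proof -
  have "\<exists>v. act M q v = u" for u
  proof (induction u arbitrary: q)
    case (Cons b u)
    obtain a where "out_letter M q a = b" using assms by (metis surjD)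
    moreover obtain v where "act M (next_state M q a) v = u" using Cons by blast
    ultimately show ?case by (intro exI[of _ "a # v"]) simp
  qed (auto intro: exI[of _ "[]"])
  then show ?thesis by (metis surjI)
qed

text \<open>A word of states acts from left to right, by \<open>fold (act M)\<close>.\<close>

primrec word_step :: "('q, 'a) mealy \<Rightarrow> 'q list \<Rightarrow> 'a list \<Rightarrow> 'q list" where
  "word_step M [] u = []"
| "word_step M (q # w) u = run (next_state M) q u # word_step M w (act M q u)"

lemma length_word_step [simp]: "length (word_step M w u) = length w"
  by (induction w arbitrary: u) simp_all

text \<open>Each state passes its output on as the input of the next one, so
  \<open>word_step M w u\<close> is the section at \<open>u\<close> of the product
  \<open>w\<close>.\<close>

lemma fold_act_append:
  "fold (act M) w (u @ v) = fold (act M) w u @ fold (act M) (word_step M w u) v"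
  by (induction w arbitrary: u v) (simp_all add: act_append)

text \<open>The section at \<open>u\<close> gives the rest of the output on inputs that begin with
  \<open>u\<close>, so the action of the product determines it.\<close>

lemma fold_act_word_step_cong:
  assumes "fold (act M) v = fold (act M) w"
  shows "fold (act M) (word_step M v u) = fold (act M) (word_step M w u)"
proof
  fix x
  show "fold (act M) (word_step M v u) x = fold (act M) (word_step M w u) x"
    using fold_act_append[of M v u x] fold_act_append[of M w u x] assms by simp
qed

section \<open>Weakly reset automata and their modified state functions\<close>

locale weakly_reset =
  fixes M :: "('q, 'a) mealy" and H :: "'a list set"
  assumes weakly_reset: "weakly_reset_mealy M H"
    and surj_out: "\<And>q. surj (out_letter M q)"
begin

abbreviation (input) "\<delta> \<equiv> next_state M"

lemma ideal: "u \<in> H \<Longrightarrow> v @ u \<in> H" "u \<in> H \<Longrightarrow> u @ v \<in> H"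
  using weakly_reset by (auto simp: weakly_reset_mealy_def two_sided_ideal_def)

lemma H_nonempty: "H \<noteq> {}"
  using weakly_reset by (simp add: weakly_reset_mealy_def)

lemma act_H: "u \<in> H \<Longrightarrow> act M q u \<in> H"
  using weakly_reset by (auto simp: weakly_reset_mealy_def)

lemma run_H: "u \<in> H \<Longrightarrow> run \<delta> q u = reset_state \<delta> u"
  using weakly_reset by (intro run_reset) (auto simp: weakly_reset_mealy_def)

lemma modified_state_H: "u \<in> H \<Longrightarrow> modified_state M H q u = reset_state \<delta> (act M q u)"
  by (simp add: modified_state_def reset_state_def)

text \<open>Outside \<open>H\<close> both restrictions are \<open>undefined\<close>.\<close>

lemma modified_state_eqI:
  "(\<And>u. u \<in> H \<Longrightarrow> modified_state M H p u = modified_state M H q u) \<Longrightarrow>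
    modified_state M H p = modified_state M H q"
  unfolding modified_state_def by (rule ext) (auto simp: restrict_def)

lemma modified_state_next:
  assumes "u \<in> H"
  shows "modified_state M H (\<delta> q a) u = modified_state M H q (a # u)"
proof -
  have au: "a # u \<in> H" using ideal(1)[OF assms, of "[a]"] by simp
  have "reset_state \<delta> (act M q (a # u)) = run \<delta> q (act M q (a # u))"
    using run_H[OF act_H[OF au]] by simp
  \<comment> \<open>The output on \<open>a # u\<close> is one letter followed by the output of
    \<open>\<delta> q a\<close> on \<open>u\<close>, and this reset word alone fixes the final
    state.\<close>
  also have "\<dots> = reset_state \<delta> (act M (\<delta> q a) u)"
    using run_H[OF act_H[OF assms]] by simp
  finally show ?thesis using assms au by (simp add: modified_state_H)
qed

lemma congruence_modified_state:
  "dfa_congruence \<delta> {(p, q). modified_state M H p = modified_state M H q}"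
  unfolding dfa_congruence_def
proof (intro conjI allI impI)
  show "equiv UNIV {(p, q). modified_state M H p = modified_state M H q}"
    by (rule equivI) (auto simp: refl_on_def sym_def trans_def)
next
  fix q p a
  assume "(q, p) \<in> {(p, q). modified_state M H p = modified_state M H q}"
  then show "(\<delta> q a, \<delta> p a) \<in> {(p, q). modified_state M H p = modified_state M H q}"
    by (auto intro!: modified_state_eqI simp: modified_state_next)
qed

lemma simple_cases:
  assumes "simple_dfa \<delta>"
  obtains "inj (modified_state M H)" | "singular M H"
proof -
  let ?R = "{(p, q). modified_state M H p = modified_state M H q}"
  have "?R = Id \<or> ?R = UNIV"
    using assms congruence_modified_state by (simp add: simple_dfa_def)
  then show thesis
  proof
    assume R: "?R = Id"
    have "p = q" if "modified_state M H p = modified_state M H q" for p q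
    proof -
      have "(p, q) \<in> ?R" using that by simp
      then show ?thesis unfolding R by simp
    qed
    then show thesis using that(1) by (simp add: inj_def)
  next
    assume R: "?R = UNIV"
    have "modified_state M H p = modified_state M H q" for p q
    proof -
      have "(p, q) \<in> ?R" unfolding R by simp
      then show ?thesis by simp
    qed
    then show thesis using that(2) by (simp add: singular_def)
  qed
qed

text \<open>A word in \<open>H\<close> sends all states to one state, which must be the
  sink.\<close>

lemma sink_imp_singular:
  assumes "\<And>a. \<delta> s a = s"
  shows "singular M H"
proof -
  have "run \<delta> s u = s" for u by (induction u) (simp_all add: assms)
  then have "reset_state \<delta> u = s" if "u \<in> H" for u using run_H[OF that] by metis
  then show ?thesis
    unfolding singular_def by (auto intro!: modified_state_eqI simp: modified_state_H act_H)
qed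

section \<open>Relations between words of states\<close>

lemma fold_act_Cons_cancel:
  assumes "fold (act M) (q # v) = fold (act M) (q # w)"
  shows "fold (act M) v = fold (act M) w"
proof
  fix x
  \<comment> \<open>\<open>fold\<close> applies the head first, so every \<open>x\<close> occurs as
    an input of the remaining product.\<close>
  obtain y where "x = act M q y" using surj_act[OF surj_out, of q] by (metis surjD)
  then show "fold (act M) v x = fold (act M) w x" using fun_cong[OF assms, of y] by simp
qed

text \<open>Reading \<open>h\<close> turns both heads into \<open>reset_state \<delta> h\<close>,
  which cancels.\<close>

lemma fold_act_reset_cancel:
  assumes "fold (act M) (p # v) = fold (act M) (q # w)" "h \<in> H"
  shows "fold (act M) (word_step M v (act M p h)) = fold (act M) (word_step M w (act M q h))"
  using fold_act_word_step_cong[OF assms(1), of h]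
  unfolding word_step.simps run_H[OF assms(2)] by (rule fold_act_Cons_cancel)

lemma fold_act_inj_length:
  assumes inj: "inj (modified_state M H)"
  shows "length v = length w \<Longrightarrow> fold (act M) v = fold (act M) w \<Longrightarrow> v = w"
proof (induction v arbitrary: w rule: length_induct)
  case (1 v)
  show ?case
  proof (cases v)
    case Nil
    then show ?thesis using 1 by simp
  next
    case (Cons p v')
    then obtain q w' where w: "w = q # w'" and len: "length v' = length w'"
      using 1(2) by (cases w) auto
    have IH: "x = y" if "length x = length v'" "length y = length v'"
      "fold (act M) x = fold (act M) y" for x y
      using 1(1) that Cons by simp
    have step: "word_step M v' (act M p h) = word_step M w' (act M q h)" if "h \<in> H" for h
      using fold_act_reset_cancel[OF 1(3)[unfolded Cons w] that] len by (intro IH) simp_all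
    have "p = q"
    \<comment> \<open>With no second state to read off a modified state, the heads themselves act
      equally.\<close>
    proof (cases v')
      case Nil
      then have "act M p = act M q" using 1(3) len Cons w by simp
      then have "modified_state M H p = modified_state M H q" by (simp add: modified_state_def)
      then show ?thesis using inj by (simp add: inj_eq)
    next
      case (Cons p2 v'')
      then obtain q2 w'' where w': "w' = q2 # w''" using len by (cases w') auto
      \<comment> \<open>The heads of the two words in \<open>step\<close> are the modified states of
        \<open>p\<close> and \<open>q\<close> at \<open>h\<close>, since \<open>act M p h\<close>
        and \<open>act M q h\<close> are reset words.\<close>
      have "modified_state M H p = modified_state M H q"
        using step by (intro modified_state_eqI) (simp add: Cons w' modified_state_H run_H act_H)
      then show ?thesis using inj by (simp add: inj_eq)
    qed
    moreover have "v' = w'"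
      using fold_act_Cons_cancel[OF 1(3)[unfolded Cons w \<open>p = q\<close>]] len by (intro IH) simp_all
    ultimately show ?thesis using Cons w by simp
  qed
qed

lemma fold_act_eq_id_imp_singular:
  assumes inj: "inj (modified_state M H)" and id: "fold (act M) (s # w) = id"
  shows "singular M H"
proof (rule sink_imp_singular)
  fix a
  \<comment> \<open>The identity is the action of the empty word, which stays empty on reading
    \<open>a\<close>.\<close>
  have "fold (act M) (word_step M (s # w) [a]) = fold (act M) (word_step M [] [a])"
    using id by (intro fold_act_word_step_cong) (simp only: fold_Nil)
  also have "\<dots> = fold (act M) (s # w)" using id by simp
  finally have "word_step M (s # w) [a] = s # w"
    by (intro fold_act_inj_length[OF inj]) simp_all
  then show "\<delta> s a = s" by simp
qed

text \<open>Each cancellation shortens both words by one, so the gap in length persists until a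
  non-empty word acts as the identity.\<close>

lemma fold_act_length_less_imp_singular:
  assumes inj: "inj (modified_state M H)"
  shows "length v < length w \<Longrightarrow> fold (act M) v = fold (act M) w \<Longrightarrow> singular M H"
proof (induction v arbitrary: w rule: length_induct)
  case (1 v)
  then obtain q w' where w: "w = q # w'" by (cases w) auto
  show ?case
  proof (cases v)
    case Nil
    then have "fold (act M) (q # w') = id" using 1(3) w by (metis fold_Nil)
    then show ?thesis by (rule fold_act_eq_id_imp_singular[OF inj])
  next
    case (Cons p v')
    obtain h where h: "h \<in> H" using H_nonempty by blast
    show ?thesis
      using 1(1)[rule_format, of "word_step M v' (act M p h)" "word_step M w' (act M q h)"]
        fold_act_reset_cancel[OF 1(3)[unfolded Cons w] h] 1(2) Cons w by simp
  qed
qed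

lemma inj_fold_act:
  assumes "inj (modified_state M H)" "\<not> singular M H"
  shows "inj (fold (act M))"
proof (rule injI)
  fix v w
  assume eq: "fold (act M) v = fold (act M) w"
  have "length v = length w"
    using fold_act_length_less_imp_singular[OF assms(1)] eq assms(2) by (metis nat_neq_iff)
  then show "v = w" using fold_act_inj_length[OF assms(1)] eq by blast
qed

end

section \<open>Freeness of the automata semigroup\<close>

lemma foldr_id_in_generated_semigroup:
  "w \<in> lists X \<Longrightarrow> w \<noteq> [] \<Longrightarrow> foldr id w \<in> generated_semigroup X"
proof (induction w)
  case (Cons f w)
  then have f: "f \<in> generated_semigroup X" by (auto intro: generated_semigroup.generator)
  show ?case
  proof (cases "w = []")
    case False
    then have "foldr id w \<in> generated_semigroup X"
      using Cons.prems by (intro Cons.IH) auto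
    with f have "f \<circ> foldr id w \<in> generated_semigroup X" by (rule generated_semigroup.comp)
    moreover have "foldr id (f # w) = f \<circ> foldr id w" by simp
    ultimately show ?thesis by argo
  qed (use f in \<open>simp only: foldr.simps id_apply comp_id\<close>)
qed simp

text \<open>\<open>foldr id\<close> evaluates a word over \<open>X\<close> as a composite; freeness
  on \<open>X\<close> thus amounts to its injectivity on non-empty words.\<close>

lemma generated_semigroup_eq_foldr:
  "generated_semigroup X = foldr id ` {w \<in> lists X. w \<noteq> []}"
proof (intro equalityI subsetI)
  fix f assume "f \<in> generated_semigroup X"
  then show "f \<in> foldr id ` {w \<in> lists X. w \<noteq> []}"
  proof induction
    case (generator f)
    then show ?case by (intro image_eqI[of _ _ "[f]"]) auto
  next
    case (comp f g)
    obtain v where v: "f = foldr id v" "v \<in> {w \<in> lists X. w \<noteq> []}"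
      using comp.IH(1) by (rule imageE)
    obtain w where w: "g = foldr id w" "w \<in> {w \<in> lists X. w \<noteq> []}"
      using comp.IH(2) by (rule imageE)
    have "f \<circ> g = foldr id (v @ w)" using v w by (simp add: fun_eq_iff)
    moreover have "v @ w \<in> {w \<in> lists X. w \<noteq> []}" using v w by simp
    ultimately show ?case by (rule image_eqI)
  qed
qed (auto intro: foldr_id_in_generated_semigroup)

lemma free_automaton_semigroup:
  assumes "inj (fold (act M))"
  shows "free_semigroup (automaton_semigroup M)"
proof -
  \<comment> \<open>\<open>foldr id\<close> applies the last factor first, \<open>fold\<close> the
    first one; hence the reversal.\<close>
  have eq: "foldr id (map (act M) w) = fold (act M) (rev w)" for w
    by (induction w) (auto simp: fun_eq_iff)
  have "inj_on (foldr id) (lists (range (act M)))"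
  proof (rule inj_onI)
    fix v w
    assume "v \<in> lists (range (act M))" "w \<in> lists (range (act M))"
      and e: "foldr id v = foldr id w"
    then obtain v' w' where vw: "v = map (act M) v'" "w = map (act M) w'"
      unfolding lists_image by auto
    then show "v = w" using e eq assms by (metis injD rev_is_rev_conv)
  qed
  then have "bij_betw (foldr id) {w \<in> lists (range (act M)). w \<noteq> []} (automaton_semigroup M)"
    unfolding bij_betw_def automaton_semigroup_def generated_semigroup_eq_foldr
    by (auto intro: inj_on_subset)
  then show ?thesis
    unfolding free_semigroup_def
    by (intro exI[of _ "range (act M)"] exI[of _ "foldr id"]) (auto simp: fun_eq_iff)
qed

text \<open>Lets the reset case be treated as a weakly reset one.\<close>

lemma weakly_reset_mealy_Syn: "reset_mealy M \<Longrightarrow> weakly_reset_mealy M (Syn (next_state M))"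
  by (simp add: reset_mealy_def weakly_reset_mealy_def synchronizing_def two_sided_ideal_Syn)

theorem theorem2:
  fixes \<delta> :: "('q::finite, 'a::finite) dfa"
    and \<chi> :: "'q \<times> 'a \<Rightarrow> 'a"
    and H :: "'a list set"
  assumes "simple_dfa \<delta>"
    and "synchronizing \<delta>"
    and "group_coloring \<delta> \<chi>"
    and "(reset_coloring \<delta> \<chi> \<and> H = Syn \<delta>) \<or> weakly_reset_coloring \<delta> \<chi> H"
  shows "free_semigroup (automaton_semigroup (coloring_mealy \<delta> \<chi>))
       \<or> singular (coloring_mealy \<delta> \<chi>) H"
proof -
  let ?M = "coloring_mealy \<delta> \<chi>"
  have \<delta>: "next_state ?M = \<delta>" by (simp add: coloring_mealy_def)
  interpret weakly_reset ?M H
  proof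
    show "weakly_reset_mealy ?M H"
      using assms(4) weakly_reset_mealy_Syn[of ?M]
      by (auto simp: reset_coloring_def weakly_reset_coloring_def \<delta>)
    \<comment> \<open>The bijection from the edges leaving \<open>q\<close> to the alphabet is the
      source of surjective outputs.\<close>
    have "range (\<lambda>a. \<chi> (q, a)) = \<chi> ` ({q} \<times> UNIV)" for q by auto
    then have "surj (\<lambda>a. \<chi> (q, a))" for q
      using assms(3) by (simp add: group_coloring_def bij_betw_def)
    then show "surj (out_letter ?M q)" for q by (simp add: coloring_mealy_def)
  qed
  have "simple_dfa (next_state ?M)" using assms(1) by (simp add: \<delta>)
  then show ?thesis
    by (rule simple_cases) (auto intro: free_automaton_semigroup inj_fold_act)
qed

end
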